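(* Let $K$ be the infinite king's grid. Then $\mathrm{RED{:}OLD}\%(K) \ge \frac{3}{10}$, where $\mathrm{RED{:}OLD}\%(K)$ denotes the lowest density of a redundant open-locating-dominating (RED:OLD) set on $K$.
   Context: The infinite king's grid $K$ is the infinite graph with vertex set $\mathbb{Z}^2$ in which two distinct vertices $(a,b)$ and $(c,d)$ are adjacent if and only if $\max(|a-c|,|b-d|)=1$ (so $K$ is 8-regular). $N(v)$ denotes the open neighborhood of $v$ (the set of vertices adjacent to $v$). A set $S \subseteq V(G)$ of vertices of a graph $G$ is an open-locating-dominating (OLD) set if, for every vertex $v$, $N(v)\cap S \neq \varnothing$, and for all distinct vertices $u,v$, $N(u)\cap S \ne N(v)\cap S$. A set $S$ is a redundant open-locating-dominating (RED:OLD) set if for every $D \subseteq S$ with $|D|\le 1$, the set $S - D$ is an OLD set (in particular $S$ itself is an OLD set). The density of $S\subseteq V(K)$ is the ratio of the size of $S$ to that of $V(K)$, understood as $\limsup_{n\to\infty} \frac{|S\cap Q_n|}{|Q_n|}$ with $Q_n=\{-n,\dots,n\}^2$. $\mathrm{RED{:}OLD}\%(K)$ is the infimum of the densities of all RED:OLD sets on $K$. *)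

theory Defs
  imports "HOL-Library.Extended_Real" "HOL-Library.Liminf_Limsup"
begin

text \<open>A simple graph is given by its vertex set \<open>V\<close> and its adjacency relation \<open>adj\<close>.\<close>

definition open_nbhd :: "'v set \<Rightarrow> ('v \<Rightarrow> 'v \<Rightarrow> bool) \<Rightarrow> 'v \<Rightarrow> 'v set" where
  "open_nbhd V adj v = {w \<in> V. adj v w}"

definition OLD_set :: "'v set \<Rightarrow> ('v \<Rightarrow> 'v \<Rightarrow> bool) \<Rightarrow> 'v set \<Rightarrow> bool" where
  "OLD_set V adj S \<longleftrightarrow>
     S \<subseteq> V \<and>
     (\<forall>v\<in>V. open_nbhd V adj v \<inter> S \<noteq> {}) \<and>
     (\<forall>u\<in>V. \<forall>v\<in>V. u \<noteq> v \<longrightarrow> open_nbhd V adj u \<inter> S \<noteq> open_nbhd V adj v \<inter> S)"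

text \<open>\<open>finite D\<close> is explicit because \<open>card\<close> of an infinite set is \<open>0\<close>.\<close>

definition RED_OLD_set :: "'v set \<Rightarrow> ('v \<Rightarrow> 'v \<Rightarrow> bool) \<Rightarrow> 'v set \<Rightarrow> bool" where
  "RED_OLD_set V adj S \<longleftrightarrow>
     S \<subseteq> V \<and> (\<forall>D. D \<subseteq> S \<and> finite D \<and> card D \<le> 1 \<longrightarrow> OLD_set V adj (S - D))"

definition king_adj :: "int \<times> int \<Rightarrow> int \<times> int \<Rightarrow> bool" where
  "king_adj = (\<lambda>(a, b) (c, d). (a, b) \<noteq> (c, d) \<and> max \<bar>a - c\<bar> \<bar>b - d\<bar> = 1)"

definition king_box :: "nat \<Rightarrow> (int \<times> int) set" where
  "king_box n = {- int n..int n} \<times> {- int n..int n}"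

text \<open>The values are extended reals so that the limit superior and the infimum below are taken
  in a complete lattice.\<close>

definition king_density :: "(int \<times> int) set \<Rightarrow> ereal" where
  "king_density S =
     limsup (\<lambda>n. ereal (real (card (S \<inter> king_box n)) / real (card (king_box n))))"

definition RED_OLD_percent_king :: ereal where
  "RED_OLD_percent_king = (INF S \<in> {S. RED_OLD_set UNIV king_adj S}. king_density S)"

text \<open>The infimum is over a nonempty family: the full vertex set is a RED:OLD set.\<close>

lemma RED_OLD_set_king_UNIV: "RED_OLD_set UNIV king_adj UNIV"
  unfolding RED_OLD_set_def
proof (intro conjI allI impI)
  fix D :: "(int \<times> int) set"
  assume "D \<subseteq> UNIV \<and> finite D \<and> card D \<le> 1"
  then obtain z where z: "D \<subseteq> {z}"
    by (metis card_le_Suc0_iff_eq One_nat_def insertI1 subsetI singletonD singletonI)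
  have two: "\<exists>w. w \<in> A \<and> w \<notin> D" if "p \<in> A" "q \<in> A" "p \<noteq> q" for p q A
    using that z by blast
  have sep: "\<exists>w. king_adj u w \<and> \<not> king_adj v w \<and> w \<notin> D"
    if ne_uv: "fst u \<noteq> fst v \<or> snd u \<noteq> snd v" for u v
  proof -
    obtain a b c d where uv: "u = (a, b)" "v = (c, d)" by (cases u, cases v)
    let ?A = "{w. king_adj u w \<and> \<not> king_adj v w}"
    consider "a < c" | "c < a" | "b < d" | "d < b" using ne_uv uv by fastforce
    then show ?thesis
    proof cases
      case 1 show ?thesis using two[of "(a-1,b-1)" ?A "(a-1,b+1)"] 1 uv
        by (auto simp: king_adj_def max_def)
    next
      case 2 show ?thesis using two[of "(a+1,b-1)" ?A "(a+1,b+1)"] 2 uv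
        by (auto simp: king_adj_def max_def)
    next
      case 3 show ?thesis using two[of "(a-1,b-1)" ?A "(a+1,b-1)"] 3 uv
        by (auto simp: king_adj_def max_def)
    next
      case 4 show ?thesis using two[of "(a-1,b+1)" ?A "(a+1,b+1)"] 4 uv
        by (auto simp: king_adj_def max_def)
    qed
  qed
  have ne: "\<exists>w. king_adj v w \<and> w \<notin> D" for v
    using sep[of v "(fst v + 1, snd v)"] by auto
  show "OLD_set UNIV king_adj (UNIV - D)"
    unfolding OLD_set_def open_nbhd_def
  proof (intro conjI ballI impI)
    fix v show "{w \<in> UNIV. king_adj v w} \<inter> (UNIV - D) \<noteq> {}" using ne[of v] by auto
  next
    fix u v :: "int \<times> int" assume "u \<noteq> v"
    then obtain w where "king_adj u w" "\<not> king_adj v w" "w \<notin> D"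
      using sep[of u v] by (metis prod.collapse)
    then show "{w \<in> UNIV. king_adj u w} \<inter> (UNIV - D) \<noteq> {w \<in> UNIV. king_adj v w} \<inter> (UNIV - D)"
      by blast
  qed simp
qed simp

end

theory Submission
  imports Defs
begin

text \<open>The share of \<open>v \<in> S\<close> is the sum of \<open>1 / |N(u) \<inter> S|\<close> over \<open>u \<in> N(v)\<close>. Every vertex \<open>u\<close>
  distributes a total of 1 among the elements of \<open>N(u) \<inter> S\<close>, so it suffices to bound the average
  share by \<open>10/3\<close>. For a RED:OLD set every \<open>|N(u) \<inter> S|\<close> is at least 2, and if
  \<open>N(u) \<inter> S = {a, b}\<close> then every other common neighbour of \<open>a\<close> and \<open>b\<close> sees at least 4 elements
  of \<open>S\<close>, since the two traces must differ in at least two places. This keeps the share of \<open>v\<close> at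
  most \<open>10/3\<close> unless the neighbours of \<open>v\<close> in \<open>S\<close> are all diagonal and include two antipodal
  ones. In that exceptional case the excess is at most \<open>1/6\<close>; it is discharged to neighbours of
  \<open>v\<close> in \<open>S\<close> that have enough room left below \<open>10/3\<close>.\<close>

section \<open>Neighbourhoods, trace sizes and shares in the king's grid\<close>

abbreviation nbhd :: "int \<times> int \<Rightarrow> (int \<times> int) set" where
  "nbhd \<equiv> open_nbhd UNIV king_adj"

lemma nbhd_eq:
  "nbhd (a, b) = {(a-1,b-1), (a-1,b), (a-1,b+1), (a,b-1), (a,b+1), (a+1,b-1), (a+1,b), (a+1,b+1)}"
proof -
  have abs_le_1: "\<bar>x - y\<bar> \<le> 1 \<longleftrightarrow> y = x - 1 \<or> y = x \<or> y = x + 1" for x y :: int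
    by arith
  have max_eq_1: "max x y = 1 \<longleftrightarrow> x \<le> 1 \<and> y \<le> 1 \<and> \<not> (x = 0 \<and> y = 0)"
    if "0 \<le> x" "0 \<le> y" for x y :: int
    using that by (cases "x \<le> y") (auto simp: max_def)
  have "king_adj (a, b) (c, d) \<longleftrightarrow> (c, d) \<noteq> (a, b) \<and> \<bar>a - c\<bar> \<le> 1 \<and> \<bar>b - d\<bar> \<le> 1" for c d
    unfolding king_adj_def prod.case max_eq_1[OF abs_ge_zero abs_ge_zero]
    by (simp add: conj_ac) blast
  then have adj: "king_adj (a, b) (c, d) \<longleftrightarrow> (c, d) \<noteq> (a, b)
      \<and> (c = a - 1 \<or> c = a \<or> c = a + 1) \<and> (d = b - 1 \<or> d = b \<or> d = b + 1)" for c d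
    unfolding abs_le_1 .
  have "nbhd (a, b) = {a-1, a, a+1} \<times> {b-1, b, b+1} - {(a, b)}"
    unfolding open_nbhd_def by (auto simp only: adj mem_Collect_eq)
  also have "\<dots> = {(a-1,b-1), (a-1,b), (a-1,b+1), (a,b-1), (a,b+1), (a+1,b-1), (a+1,b), (a+1,b+1)}"
  proof -
    have "{x, y, z} \<times> {x', y', z'} - {(y, y')} =
        {(x,x'), (x,y'), (x,z'), (y,x'), (y,z'), (z,x'), (z,y'), (z,z')}"
      if "x \<noteq> y" "z \<noteq> y" "x' \<noteq> y'" "z' \<noteq> y'" for x y z x' y' z' :: int
      using that by blast
    then show ?thesis by simp
  qed
  finally show ?thesis .
qed

lemma nbhd_sym: "u \<in> nbhd v \<longleftrightarrow> v \<in> nbhd u"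
  by (cases u; cases v) (auto simp: open_nbhd_def king_adj_def abs_minus_commute)

lemma finite_nbhd [simp]: "finite (nbhd v)"
  by (cases v) (simp add: nbhd_eq)

lemma card_nbhd: "card (nbhd v) = 8"
  by (cases v) (simp add: nbhd_eq)

definition ndom :: "(int \<times> int) set \<Rightarrow> int \<times> int \<Rightarrow> nat" where
  "ndom S u = card (nbhd u \<inter> S)"

definition weight :: "(int \<times> int) set \<Rightarrow> int \<times> int \<Rightarrow> real" where
  "weight S u = 1 / ndom S u"

definition share :: "(int \<times> int) set \<Rightarrow> int \<times> int \<Rightarrow> real" where
  "share S v = sum (weight S) (nbhd v)"

lemma sum_nbhd:
  fixes f :: "int \<times> int \<Rightarrow> 'a::comm_monoid_add"
  shows "sum f (nbhd (a, b)) = f (a-1,b-1) + f (a-1,b) + f (a-1,b+1) + f (a,b-1) + f (a,b+1)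
    + f (a+1,b-1) + f (a+1,b) + f (a+1,b+1)"
  by (simp add: nbhd_eq add.assoc)

lemma ndom_eq_sum: "ndom S u = (\<Sum>w\<in>nbhd u. of_bool (w \<in> S))"
  unfolding ndom_def by (simp add: Int_def)

lemma ndom_ge: "X \<subseteq> nbhd u \<inter> S \<Longrightarrow> card X \<le> ndom S u"
  unfolding ndom_def by (simp add: card_mono)

section \<open>Shares at the origin\<close>

locale red_old =
  fixes S :: "(int \<times> int) set"
  assumes ndom_ge_2: "ndom S u \<ge> 2"
    and nbhd_diff_ge_2: "u \<noteq> v \<Longrightarrow> card ((nbhd u - nbhd v \<union> (nbhd v - nbhd u)) \<inter> S) \<ge> 2"

text \<open>If a trace, or the symmetric difference of two traces, held at most one element of
  \<open>S\<close>, that part of \<open>S\<close> would be an admissible \<open>D\<close>; removing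
  it would empty the trace or make the two traces equal.\<close>

lemma red_oldI:
  assumes "RED_OLD_set UNIV king_adj S"
  shows "red_old S"
proof -
  have OLD: "OLD_set UNIV king_adj (S - A \<inter> S)" if "\<not> card (A \<inter> S) \<ge> 2" "finite A" for A
  proof -
    have "A \<inter> S \<subseteq> S \<and> finite (A \<inter> S) \<and> card (A \<inter> S) \<le> 1" using that by auto
    then show ?thesis using assms unfolding RED_OLD_set_def by blast
  qed
  have "ndom S u \<ge> 2" for u
  proof (rule ccontr)
    assume "\<not> ?thesis"
    then have "OLD_set UNIV king_adj (S - nbhd u \<inter> S)"
      by (intro OLD) (simp_all add: ndom_def)
    then have "nbhd u \<inter> (S - nbhd u \<inter> S) \<noteq> {}" unfolding OLD_set_def by (metis UNIV_I)
    then show False by blast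
  qed
  moreover have "card ((nbhd u - nbhd v \<union> (nbhd v - nbhd u)) \<inter> S) \<ge> 2" if "u \<noteq> v" for u v
  proof (rule ccontr)
    let ?D = "nbhd u - nbhd v \<union> (nbhd v - nbhd u)"
    assume "\<not> 2 \<le> card (?D \<inter> S)"
    then have "OLD_set UNIV king_adj (S - ?D \<inter> S)" by (rule OLD) simp
    then have "nbhd u \<inter> (S - ?D \<inter> S) \<noteq> nbhd v \<inter> (S - ?D \<inter> S)"
      using \<open>u \<noteq> v\<close> unfolding OLD_set_def by (metis UNIV_I)
    then show False by blast
  qed
  ultimately show ?thesis unfolding red_old_def by blast
qed

context red_old
begin

section \<open>Weight bounds at vertices that see a common pair of \<open>S\<close>\<close>

lemma nbhd_Int_eqI:
  assumes "ndom S u = 2" "a \<noteq> b" "{a, b} \<subseteq> nbhd u \<inter> S"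
  shows "nbhd u \<inter> S = {a, b}"
  using card_subset_eq[of "nbhd u \<inter> S" "{a, b}"] assms by (simp add: ndom_def)

lemma ndom_ge_4:
  assumes "ndom S u = 2" "a \<noteq> b" "u \<noteq> v" "{a, b} \<subseteq> nbhd u \<inter> S" "{a, b} \<subseteq> nbhd v \<inter> S"
  shows "ndom S v \<ge> 4"
proof -
  have eq: "nbhd u \<inter> S = {a, b}" using nbhd_Int_eqI assms by blast
  have "(nbhd u - nbhd v \<union> (nbhd v - nbhd u)) \<inter> S = nbhd v \<inter> S - {a, b}"
    using eq assms(5) by blast
  then have "2 \<le> card (nbhd v \<inter> S - {a, b})"
    using nbhd_diff_ge_2[OF assms(3)] by simp
  also have "card (nbhd v \<inter> S - {a, b}) = ndom S v - 2"
    using assms(2,5) by (subst card_Diff_subset) (auto simp: ndom_def)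
  finally show ?thesis by simp
qed

lemma weight_le: "0 < n \<Longrightarrow> n \<le> ndom S u \<Longrightarrow> weight S u \<le> 1 / n"
  by (simp add: weight_def frac_le)

lemma weight_le_half: "weight S u \<le> 1 / 2"
  using weight_le[of 2 u] ndom_ge_2[of u] by simp

lemma weight_le_third: "ndom S u \<noteq> 2 \<Longrightarrow> weight S u \<le> 1 / 3"
  using weight_le[of 3 u] ndom_ge_2[of u] by simp

lemma weight_le_quarter: "ndom S u \<ge> 4 \<Longrightarrow> weight S u \<le> 1 / 4"
  using weight_le[of 4 u] by simp

text \<open>The extreme case is one trace of size 2 and the other of size at least 4, giving
  \<open>1 / 2 + 1 / 4\<close>; without a trace of size 2 the sum is at most
  \<open>2 / 3\<close>.\<close>

lemma pair_le:
  assumes "a \<noteq> b" "u \<noteq> v" "{a, b} \<subseteq> nbhd u \<inter> S" "{a, b} \<subseteq> nbhd v \<inter> S"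
  shows "weight S u + weight S v \<le> 3 / 4"
proof -
  consider "ndom S u = 2" "ndom S v \<ge> 4" | "ndom S v = 2" "ndom S u \<ge> 4" | "ndom S u \<noteq> 2" "ndom S v \<noteq> 2"
    using ndom_ge_4[of u a b v] ndom_ge_4[of v a b u] assms by auto
  then show ?thesis
    by cases (use weight_le_quarter[of u] weight_le_quarter[of v] weight_le_third[of u]
        weight_le_third[of v] weight_le_half[of u] weight_le_half[of v] in auto)
qed

text \<open>Meant for two orthogonally adjacent \<open>a\<close>, \<open>b\<close>, which have four
  common neighbours. A trace of size 2 at one of them forces weight at most \<open>1 / 4\<close> on
  the other three, so the sum is at most \<open>5 / 4\<close>. Otherwise every weight is at most
  \<open>1 / 3\<close>, and a trace of size at least 4 saves another \<open>1 / 12\<close>.\<close>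

lemma sum_weight_le:
  assumes U: "finite U" "card U = 4" and "a \<noteq> b" and ab: "\<And>u. u \<in> U \<Longrightarrow> {a, b} \<subseteq> nbhd u \<inter> S"
  shows "(\<Sum>u\<in>U. weight S u) \<le> 4 / 3"
    and "\<exists>u\<in>U. ndom S u \<ge> 4 \<Longrightarrow> (\<Sum>u\<in>U. weight S u) \<le> 5 / 4"
proof -
  have two: "(\<Sum>u\<in>U. weight S u) \<le> 5 / 4" if "z \<in> U" "ndom S z = 2" for z
  proof -
    have "ndom S u \<ge> 4" if "u \<in> U - {z}" for u
      using ndom_ge_4[of z a b u] that \<open>z \<in> U\<close> \<open>ndom S z = 2\<close> \<open>a \<noteq> b\<close> ab[of z] ab[of u] by auto
    then have "(\<Sum>u\<in>U - {z}. weight S u) \<le> of_nat (card (U - {z})) * (1 / 4)"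
      by (intro sum_bounded_above weight_le_quarter)
    then show ?thesis using that U weight_le_half[of z] by (simp add: sum.remove[of U z])
  qed
  have third: "(\<Sum>u\<in>V. weight S u) \<le> of_nat (card V) * (1 / 3)" if "V \<subseteq> U" "\<forall>u\<in>U. ndom S u \<noteq> 2" for V
    using that by (intro sum_bounded_above weight_le_third) blast
  show "(\<Sum>u\<in>U. weight S u) \<le> 4 / 3"
  proof (cases "\<exists>z\<in>U. ndom S z = 2")
    case True
    then obtain z where "z \<in> U" "ndom S z = 2" by blast
    from two[OF this] show ?thesis by simp
  next
    case False
    then show ?thesis using third[of U] U by simp
  qed
  assume "\<exists>u\<in>U. ndom S u \<ge> 4"
  then obtain z where z: "z \<in> U" "ndom S z \<ge> 4" by blast
  show "(\<Sum>u\<in>U. weight S u) \<le> 5 / 4"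
  proof (cases "\<exists>z\<in>U. ndom S z = 2")
    case True
    then obtain z where "z \<in> U" "ndom S z = 2" by blast
    then show ?thesis by (rule two)
  next
    case False
    then have "(\<Sum>u\<in>U - {z}. weight S u) \<le> 1"
      using third[of "U - {z}"] U z by simp
    moreover have "(\<Sum>u\<in>U. weight S u) = weight S z + (\<Sum>u\<in>U - {z}. weight S u)"
      using U z by (simp add: sum.remove)
    ultimately show ?thesis using weight_le_quarter[OF z(2)] by linarith
  qed
qed

lemma ex_third:
  assumes "ndom S u \<ge> 3"
  obtains e where "e \<in> nbhd u \<inter> S" "e \<noteq> a" "e \<noteq> b"
proof -
  have "\<not> nbhd u \<inter> S \<subseteq> {a, b}"
  proof
    assume "nbhd u \<inter> S \<subseteq> {a, b}"
    from card_mono[OF _ this] assms card_insert_le_m1[of 2 "{b}" a] show False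
      by (simp add: ndom_def)
  qed
  then show thesis using that by blast
qed

lemma ex_second:
  obtains e where "e \<in> nbhd u \<inter> S" "e \<noteq> a"
proof -
  have "\<not> nbhd u \<inter> S \<subseteq> {a}"
    using card_mono[of "{a}" "nbhd u \<inter> S"] ndom_ge_2[of u] by (auto simp: ndom_def)
  then show thesis using that by blast
qed

section \<open>Bounding the share by \<open>10 / 3\<close> outside the exceptional case\<close>

lemma share_orth:
  assumes "(0, 0) \<in> S" "(1, 0) \<in> S"
  shows "share S (0, 0) \<le> 10 / 3"
proof -
  have "(\<Sum>u\<in>{(0,1), (0,-1), (1,1), (1,-1)}. weight S u) \<le> 4 / 3"
    by (rule sum_weight_le(1)[where a = "(0,0)" and b = "(1,0)"])
      (use assms in \<open>auto simp: nbhd_eq\<close>)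
  then show ?thesis
    using weight_le_half[of "(1,0)"] weight_le_half[of "(-1,0)"]
      weight_le_half[of "(-1,1)"] weight_le_half[of "(-1,-1)"]
    unfolding share_def sum_nbhd by simp
qed

text \<open>Only the column \<open>x = -2\<close> is left for \<open>e\<close>, and each of its
  three vertices adjacent to \<open>(-1,0)\<close> is also adjacent to a corner. Thus
  \<open>(-1,0)\<close> and that corner share a pair of \<open>S\<close>.\<close>

lemma ex_common_corner:
  assumes "(0, 0) \<in> S" "e \<in> nbhd (-1,0) \<inter> S" "e \<notin> {(0,0), (-1,1), (-1,-1), (0,1), (0,-1)}"
  obtains c where "c \<in> {(-1,1), (-1,-1)}" "{(0,0), e} \<subseteq> nbhd c \<inter> S" "{(0,0), e} \<subseteq> nbhd (-1,0) \<inter> S"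
proof -
  have "e = (-2,-1) \<or> e = (-2,0) \<or> e = (-2,1)"
    using assms(2,3) unfolding nbhd_eq Int_iff insert_iff by simp
  then have "e \<in> nbhd (-1,1) \<or> e \<in> nbhd (-1,-1)" by (elim disjE) (simp_all add: nbhd_eq)
  moreover have "(0,0) \<in> nbhd (-1,1)" "(0,0) \<in> nbhd (-1,-1)" "(0,0) \<in> nbhd (-1,0)"
    by (simp_all add: nbhd_eq)
  ultimately show thesis using that assms(1,2) by blast
qed

lemma left_column_weight_le:
  assumes "(0, 0) \<in> S" "{(-1,1), (-1,-1), (0,1), (0,-1)} \<inter> S = {}"
  shows "weight S (-1,0) + weight S (-1,1) + weight S (-1,-1) \<le> 5 / 4"
proof -
  obtain e where e: "e \<in> nbhd (-1,0) \<inter> S" "e \<noteq> (0,0)" by (rule ex_second)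
  with assms(2) have "e \<notin> {(0,0), (-1,1), (-1,-1), (0,1), (0,-1)}" by blast
  with assms(1) e(1) obtain c where c: "c \<in> {(-1,1), (-1,-1)}"
    "{(0,0), e} \<subseteq> nbhd c \<inter> S" "{(0,0), e} \<subseteq> nbhd (-1,0) \<inter> S" by (rule ex_common_corner)
  have "(-1,0) \<noteq> c" using c(1) by auto
  then have "weight S (-1,0) + weight S c \<le> 3 / 4"
    using pair_le[of "(0,0)" e "(-1,0)" c] e(2) c by blast
  then show ?thesis
    using c(1) weight_le_half[of "(-1,1)"] weight_le_half[of "(-1,-1)"] by auto
qed

lemma left_column_weight_le_1:
  assumes "(0, 0) \<in> S" "{(-1,1), (-1,-1), (0,1), (0,-1), (-1,0)} \<inter> S = {}"
    and "{(-1,2), (0,2), (-1,-2), (0,-2)} \<inter> S = {}"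
  shows "weight S (-1,0) + weight S (-1,1) + weight S (-1,-1) \<le> 1"
proof -
  have ndom: "ndom S (-1,0) = 1 + of_bool ((-2,-1) \<in> S) + of_bool ((-2,0) \<in> S) + of_bool ((-2,1) \<in> S)"
    "ndom S (-1,1) = 1 + of_bool ((-2,0) \<in> S) + of_bool ((-2,1) \<in> S) + of_bool ((-2,2) \<in> S)"
    "ndom S (-1,-1) = 1 + of_bool ((-2,-2) \<in> S) + of_bool ((-2,-1) \<in> S) + of_bool ((-2,0) \<in> S)"
    using assms by (simp_all add: ndom_eq_sum sum_nbhd)
  have *: "ndom S v \<ge> 4"
    if "ndom S u = 2" "e \<in> S" "e \<in> nbhd u \<inter> nbhd v" "(0,0) \<in> nbhd u \<inter> nbhd v" "u \<noteq> v" "e \<noteq> (0,0)" for e u v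
    using ndom_ge_4[of u "(0,0)" e v] that assms(1) by auto
  have "(-2,0) \<in> S \<or> (-2,1) \<in> S \<Longrightarrow> ndom S (-1,0) = 2 \<Longrightarrow> ndom S (-1,1) \<ge> 4"
    "(-2,0) \<in> S \<or> (-2,-1) \<in> S \<Longrightarrow> ndom S (-1,0) = 2 \<Longrightarrow> ndom S (-1,-1) \<ge> 4"
    "(-2,0) \<in> S \<or> (-2,1) \<in> S \<Longrightarrow> ndom S (-1,1) = 2 \<Longrightarrow> ndom S (-1,0) \<ge> 4"
    "(-2,0) \<in> S \<or> (-2,-1) \<in> S \<Longrightarrow> ndom S (-1,-1) = 2 \<Longrightarrow> ndom S (-1,0) \<ge> 4"
    by (auto intro!: * simp: nbhd_eq)
  \<comment> \<open>Apart from the origin, all three traces lie in five cells of the column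
    \<open>x = -2\<close>; the 32 patterns are checked against the four implications and
    \<open>ndom_ge_2\<close> at \<open>(-1,0)\<close>.\<close>
  then have "ndom S (-1,0) \<noteq> 2 \<and> ndom S (-1,1) \<noteq> 2 \<and> ndom S (-1,-1) \<noteq> 2"
    using ndom_ge_2[of "(-1,0)"] unfolding ndom
    by (cases "(-2,-1) \<in> S"; cases "(-2,0) \<in> S"; cases "(-2,1) \<in> S"; cases "(-2,2) \<in> S";
        cases "(-2,-2) \<in> S") simp_all
  then show ?thesis
    using weight_le_third[of "(-1,0)"] weight_le_third[of "(-1,1)"] weight_le_third[of "(-1,-1)"]
    by simp
qed

text \<open>The two right corners take at most 1. If \<open>(0,1)\<close> and \<open>(0,-1)\<close>
  both have traces of size 2, these exclude the vertices above and below from \<open>S\<close>,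
  which sharpens the bound on the left column from \<open>5 / 4\<close> to 1; the total is
  \<open>13 / 4\<close>. Otherwise \<open>(1,0)\<close>, \<open>(0,1)\<close>, \<open>(0,-1)\<close>
  weigh at most \<open>1 / 2 + 1 / 3 + 1 / 4 = 13 / 12\<close>, for a total of
  \<open>10 / 3\<close>.\<close>

lemma share_adjacent_diagonals:
  assumes "(0, 0) \<in> S" "{(-1,1), (-1,-1), (0,1), (0,-1), (-1,0), (1,0)} \<inter> S = {}"
    and "{(1,1), (1,-1)} \<subseteq> S"
  shows "share S (0, 0) \<le> 10 / 3"
proof -
  have "ndom S (1,0) \<ge> 3"
    using ndom_ge[of "{(0,0), (1,1), (1,-1)}" "(1,0)" S] assms by (simp add: nbhd_eq)
  then have r: "weight S (1,0) \<le> 1 / 3" by (intro weight_le_third) simp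
  have n: "{(0,0), (1,1)} \<subseteq> nbhd (0,1) \<inter> S" "{(0,0), (1,-1)} \<subseteq> nbhd (0,-1) \<inter> S"
    using assms by (auto simp: nbhd_eq)
  have up: "ndom S (0,1) = 2 \<Longrightarrow> ndom S (1,0) \<ge> 4" "ndom S (0,-1) = 2 \<Longrightarrow> ndom S (1,0) \<ge> 4"
    using ndom_ge_4[OF _ _ _ n(1), of "(1,0)"] ndom_ge_4[OF _ _ _ n(2), of "(1,0)"] assms
    by (auto simp: nbhd_eq)
  note bounds = r weight_le_half[of "(1,1)"] weight_le_half[of "(1,-1)"]
    weight_le_half[of "(0,1)"] weight_le_half[of "(0,-1)"]
    weight_le_third[of "(0,1)"] weight_le_third[of "(0,-1)"] weight_le_quarter[of "(1,0)"]
    left_column_weight_le assms(1,2) up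
  show ?thesis
  proof (cases "ndom S (0,1) = 2 \<and> ndom S (0,-1) = 2")
    case True
    then have eq: "nbhd (0,1) \<inter> S = {(0,0), (1,1)}" "nbhd (0,-1) \<inter> S = {(0,0), (1,-1)}"
      using nbhd_Int_eqI n by auto
    have "w \<notin> S" if "w \<in> {(-1,2), (0,2), (-1,-2), (0,-2)}" for w
    proof -
      have "w \<in> nbhd (0,1) \<union> nbhd (0,-1)" "w \<notin> {(0,0), (1,1), (1,-1)}"
        using that by (auto simp: nbhd_eq)
      then show ?thesis using eq by blast
    qed
    then have "{(-1,2), (0,2), (-1,-2), (0,-2)} \<inter> S = {}" by blast
    then have "weight S (-1,0) + weight S (-1,1) + weight S (-1,-1) \<le> 1"
      using left_column_weight_le_1 assms by simp
    then show ?thesis using bounds True unfolding share_def sum_nbhd by simp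
  next
    case False
    then have "weight S (1,0) + weight S (0,1) + weight S (0,-1) \<le> 13 / 12"
      using bounds(1-8) up by (cases "ndom S (0,1) = 2"; cases "ndom S (0,-1) = 2") simp_all
    then show ?thesis using bounds unfolding share_def sum_nbhd by simp
  qed
qed

section \<open>The exceptional case: antipodal diagonal neighbours in \<open>S\<close>\<close>

lemma high_antipodal:
  assumes "(0, 0) \<in> S" "{(-1,1), (1,-1)} \<subseteq> S" "10 / 3 < share S (0, 0)"
  shows "weight S (-1,0) + weight S (0,1) \<le> 3 / 4"
    and "weight S (0,-1) + weight S (1,0) \<le> 3 / 4"
    and "share S (0, 0) \<le> 7 / 2"
    and "c \<in> {(1,1), (1,-1), (-1,1), (-1,-1)} \<Longrightarrow> ndom S c = 2"
proof -
  show 1: "weight S (-1,0) + weight S (0,1) \<le> 3 / 4"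
    by (rule pair_le[of "(0,0)" "(-1,1)"]) (use assms in \<open>auto simp: nbhd_eq\<close>)
  show 2: "weight S (0,-1) + weight S (1,0) \<le> 3 / 4"
    by (rule pair_le[of "(0,0)" "(1,-1)"]) (use assms in \<open>auto simp: nbhd_eq\<close>)
  note half = weight_le_half[of "(1,1)"] weight_le_half[of "(1,-1)"]
    weight_le_half[of "(-1,1)"] weight_le_half[of "(-1,-1)"]
  show "share S (0, 0) \<le> 7 / 2" using 1 2 half unfolding share_def sum_nbhd by simp
  show "ndom S c = 2" if "c \<in> {(1,1), (1,-1), (-1,1), (-1,-1)}"
  proof (rule ccontr)
    assume "ndom S c \<noteq> 2"
    \<comment> \<open>Relative to \<open>7 / 2\<close>, this corner saves
      \<open>1 / 2 - 1 / 3 = 1 / 6\<close>, the whole excess over \<open>10 / 3\<close>.\<close>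
    then have "weight S c \<le> 1 / 3" by (rule weight_le_third)
    then have "share S (0, 0) \<le> 10 / 3"
      using 1 2 half that unfolding share_def sum_nbhd by auto
    then show False using assms(3) by simp
  qed
qed

text \<open>A third element of the trace lies in the column \<open>x = -2\<close>, so
  \<open>(-1,0)\<close> shares it and the origin with a corner whose trace has size 2.\<close>

lemma ndom_orth_ge_4:
  assumes "(0, 0) \<in> S" "(-1,1) \<in> S" "{(-1,-1), (0,1), (0,-1)} \<inter> S = {}"
    and "ndom S (-1,1) = 2" "ndom S (-1,-1) = 2" "ndom S (-1,0) \<noteq> 2"
  shows "ndom S (-1,0) \<ge> 4"
proof -
  have "ndom S (-1,0) \<ge> 3" using ndom_ge_2[of "(-1,0)"] assms(6) by simp
  then obtain e where e: "e \<in> nbhd (-1,0) \<inter> S" "e \<noteq> (0,0)" "e \<noteq> (-1,1)" by (rule ex_third)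
  with assms(3) have "e \<notin> {(0,0), (-1,1), (-1,-1), (0,1), (0,-1)}" by blast
  with assms(1) e(1) obtain c where c: "c \<in> {(-1,1), (-1,-1)}"
    "{(0,0), e} \<subseteq> nbhd c \<inter> S" "{(0,0), e} \<subseteq> nbhd (-1,0) \<inter> S" by (rule ex_common_corner)
  have "(-1,0) \<noteq> c" "ndom S c = 2" using c(1) assms by auto
  then show ?thesis using ndom_ge_4[of c "(0,0)" e "(-1,0)"] e(2) c by blast
qed

text \<open>Makes \<open>(1,1)\<close> a receiver: with a trace of size 2 it is asked for at most
  \<open>2 * (1 / 6)\<close>, and a share of at most 3 leaves that much room.\<close>

lemma share_three_diagonals:
  assumes S: "(0, 0) \<in> S" "{(-1,1), (1,-1), (1,1)} \<subseteq> S"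
    and iso: "{(-1,0), (0,1), (0,-1), (1,0)} \<inter> S = {}"
    and high: "10 / 3 < share S (0, 0)"
  shows "ndom S (1,1) = 2" "share S (1,1) \<le> 3"
proof -
  have qs: "{(-1,1), (1,-1)} \<subseteq> S" using S by blast
  note corner = high_antipodal(4)[OF S(1) qs high]
  have c2: "ndom S (1,1) = 2" "ndom S (1,-1) = 2" "ndom S (-1,1) = 2" "ndom S (-1,-1) = 2"
    by (rule corner; simp)+
  show "ndom S (1,1) = 2" by fact
  have ge3: "ndom S (0,1) \<ge> 3" "ndom S (1,0) \<ge> 3" "ndom S (0,0) \<ge> 3"
    using ndom_ge[of "{(0,0), (1,1), (-1,1)}" "(0,1)" S] ndom_ge[of "{(0,0), (1,1), (1,-1)}" "(1,0)" S]
      ndom_ge[of "{(-1,1), (1,1), (1,-1)}" "(0,0)" S] S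
    by (simp_all add: nbhd_eq)
  have w3: "weight S (0,1) \<le> 1 / 3" "weight S (1,0) \<le> 1 / 3" "weight S (0,0) \<le> 1 / 3"
    by (rule weight_le_third; use ge3 in simp)+
  have corner_half: "weight S (1,1) \<le> 1 / 2" "weight S (1,-1) \<le> 1 / 2" "weight S (-1,1) \<le> 1 / 2"
    "weight S (-1,-1) \<le> 1 / 2"
    by (rule weight_le_half)+
  have not_S: "(-1,-1) \<notin> S"
  proof
    assume "(-1,-1) \<in> S"
    then have "ndom S (-1,0) \<ge> 3" "ndom S (0,-1) \<ge> 3"
      using ndom_ge[of "{(0,0), (-1,-1), (-1,1)}" "(-1,0)" S]
        ndom_ge[of "{(0,0), (-1,-1), (1,-1)}" "(0,-1)" S] S
      by (simp_all add: nbhd_eq)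
    then have "weight S (-1,0) \<le> 1 / 3" "weight S (0,-1) \<le> 1 / 3"
      using weight_le_third[of "(-1,0)"] weight_le_third[of "(0,-1)"] by auto
    then have "share S (0, 0) \<le> 10 / 3"
      using w3 corner_half unfolding share_def sum_nbhd by simp
    then show False using high by simp
  qed
  \<comment> \<open>If the trace of \<open>(-1,0)\<close> has size 2, its pair is also seen by
    \<open>(0,1)\<close>. Otherwise \<open>(-1,0)\<close> weighs at most \<open>1 / 4\<close>, and
    the share drops to \<open>1 / 4 + 1 / 3 + 3 / 4 + 2 = 10 / 3\<close>.\<close>
  have ge4: "ndom S (0,1) \<ge> 4"
  proof (cases "ndom S (-1,0) = 2")
    case True
    show ?thesis
      by (rule ndom_ge_4[OF True, of "(0,0)" "(-1,1)"]) (use S in \<open>simp_all add: nbhd_eq\<close>)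
  next
    case False
    then have "ndom S (-1,0) \<ge> 4"
      by (intro ndom_orth_ge_4) (use S iso not_S c2 in simp_all)
    then have "weight S (-1,0) \<le> 1 / 4" by (rule weight_le_quarter)
    then have "share S (0, 0) \<le> 10 / 3"
      using high_antipodal(2)[OF S(1) qs high] w3 corner_half unfolding share_def sum_nbhd by simp
    then show ?thesis using high by simp
  qed
  note half = weight_le_half[of "(0,2)"] weight_le_half[of "(1,2)"] weight_le_half[of "(2,2)"]
    weight_le_half[of "(2,1)"] weight_le_half[of "(2,0)"]
  have share: "share S (1,1) = weight S (0,0) + weight S (0,1) + weight S (0,2) + weight S (1,0)
      + weight S (1,2) + weight S (2,0) + weight S (2,1) + weight S (2,2)"
    unfolding share_def sum_nbhd by simp
  obtain f where f: "f \<in> nbhd (1,1) \<inter> S" "f \<noteq> (0,0)" by (rule ex_second)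
  have "(0,0) \<in> nbhd (1,1)" by (simp add: nbhd_eq)
  then have p: "{(0,0), f} \<subseteq> nbhd (1,1) \<inter> S" using f(1) S(1) by blast
  \<comment> \<open>For \<open>f\<close> at \<open>(2,0)\<close> or \<open>(0,2)\<close>, the pair
    \<open>{(0,0), f}\<close> would be seen by two corners whose traces both have size 2.\<close>
  have "f \<noteq> (2,0)"
  proof
    assume "f = (2,0)"
    then have "{(0,0), f} \<subseteq> nbhd (1,-1) \<inter> S" using f S by (simp add: nbhd_eq)
    from ndom_ge_4[OF c2(1) _ _ p this] f(2) c2(2) show False by auto
  qed
  moreover have "f \<noteq> (0,2)"
  proof
    assume "f = (0,2)"
    then have "{(0,0), f} \<subseteq> nbhd (-1,1) \<inter> S" using f S by (simp add: nbhd_eq)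
    from ndom_ge_4[OF c2(1) _ _ p this] f(2) c2(3) show False by auto
  qed
  moreover have "f \<noteq> (0,1)" "f \<noteq> (1,0)" using f(1) iso by auto
  ultimately have "f = (2,1) \<or> f = (1,2) \<or> f = (2,2)"
    using f unfolding nbhd_eq Int_iff insert_iff by simp blast
  then consider "f = (2,1)" | "f = (1,2)" | "f = (2,2)" by blast
  then show "share S (1,1) \<le> 3"
  proof cases
    case 1
    have "sum (weight S) {(1,0), (1,2), (2,0), (2,2)} \<le> 4 / 3"
      by (rule sum_weight_le(1)[where a = "(1,1)" and b = "(2,1)"])
        (use S f 1 in \<open>auto simp: nbhd_eq\<close>)
    then show ?thesis using w3 half unfolding share by simp
  next
    case 2
    have "sum (weight S) {(0,1), (2,1), (0,2), (2,2)} \<le> 4 / 3"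
      by (rule sum_weight_le(1)[where a = "(1,1)" and b = "(1,2)"])
        (use S f 2 in \<open>auto simp: nbhd_eq\<close>)
    then show ?thesis using w3 half unfolding share by simp
  next
    case 3
    have "weight S (1,2) + weight S (2,1) \<le> 3 / 4"
      by (rule pair_le[of "(1,1)" "(2,2)"]) (use S f 3 in \<open>auto simp: nbhd_eq\<close>)
    \<comment> \<open>The trace of \<open>(1,1)\<close> rules out \<open>(0,2)\<close> and
      \<open>(1,2)\<close>, so the fourth element seen by \<open>(0,1)\<close> must be
      \<open>(-1,2)\<close>; it lowers the weight of \<open>(0,2)\<close> to
      \<open>1 / 3\<close>.\<close>
    moreover have "(-1,2) \<in> S"
    proof -
      have "nbhd (1,1) \<inter> S = {(0,0), (2,2)}" using nbhd_Int_eqI[OF c2(1) _ p] 3 by simp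
      then have "(0,2) \<notin> nbhd (1,1) \<inter> S" "(1,2) \<notin> nbhd (1,1) \<inter> S"
        by (simp_all del: Int_iff)
      moreover have "(0,2) \<in> nbhd (1,1)" "(1,2) \<in> nbhd (1,1)" by (simp_all add: nbhd_eq)
      ultimately have "(0,2) \<notin> S" "(1,2) \<notin> S" by simp_all
      then have "ndom S (0,1) = 3 + of_bool ((-1,2) \<in> S)"
        using S iso by (simp add: ndom_eq_sum sum_nbhd)
      then show ?thesis using ge4 by (cases "(-1,2) \<in> S") simp_all
    qed
    then have "ndom S (0,2) \<ge> 3"
      using ndom_ge[of "{(1,1), (-1,1), (-1,2)}" "(0,2)" S] S by (simp add: nbhd_eq)
    then have "weight S (0,2) \<le> 1 / 3" using weight_le_third[of "(0,2)"] by auto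
    ultimately show ?thesis using w3 half weight_le_quarter[OF ge4] unfolding share by simp
  qed
qed

end

section \<open>Symmetries of the grid\<close>

definition king_aut :: "(int \<times> int \<Rightarrow> int \<times> int) \<Rightarrow> bool" where
  "king_aut g \<longleftrightarrow> bij g \<and> (\<forall>u v. king_adj (g u) (g v) = king_adj u v)"

lemma king_aut_comp: "king_aut f \<Longrightarrow> king_aut g \<Longrightarrow> king_aut (f \<circ> g)"
  unfolding king_aut_def by (metis bij_comp comp_apply)

lemma king_aut_shift: "king_aut (\<lambda>(x, y). (a + x, b + y))"
proof -
  have "bij (\<lambda>(x, y). (a + x, b + y))"
    by (rule o_bij[where g = "\<lambda>(x, y). (x - a, y - b)"]) auto
  then show ?thesis unfolding king_aut_def by (auto simp: king_adj_def)
qed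

lemma king_aut_flip: "king_aut (\<lambda>(x, y). (- x, y))"
proof -
  have "bij (\<lambda>(x :: int, y :: int). (- x, y))"
    by (rule o_bij[where g = "\<lambda>(x, y). (- x, y)"]) auto
  moreover have "\<bar>a - b\<bar> = \<bar>b - a\<bar>" for a b :: int by (rule abs_minus_commute)
  ultimately show ?thesis unfolding king_aut_def by (simp add: king_adj_def split: prod.split)
qed

lemma king_aut_swap: "king_aut (\<lambda>(x, y). (y, x))"
proof -
  have "bij (\<lambda>(x :: int, y :: int). (y, x))"
    by (rule o_bij[where g = "\<lambda>(x, y). (y, x)"]) auto
  then show ?thesis unfolding king_aut_def by (auto simp: king_adj_def max.commute)
qed

text \<open>\<open>13 / 4\<close> is \<open>10 / 3 - 1 / 12\<close>, room for one contribution of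
  \<open>1 / 12\<close>; the second condition leaves \<open>v\<close> as the only possible
  donor.\<close>

definition quiet :: "(int \<times> int) set \<Rightarrow> int \<times> int \<Rightarrow> int \<times> int \<Rightarrow> bool" where
  "quiet S v w \<longleftrightarrow> share S w \<le> 13 / 4 \<and> (\<forall>y\<in>nbhd w \<inter> S. y \<noteq> v \<longrightarrow> share S y \<le> 10 / 3)"

text \<open>A vertex \<open>v\<close> of share at most \<open>7/2\<close> has to give away \<open>1/6\<close>. In the first alternative it has at
  least two neighbours in \<open>S\<close>, each of which can absorb \<open>1/12\<close> and is not asked by any other vertex.
  In the second one, \<open>w\<close> can absorb \<open>1/6\<close> from both of its neighbours in \<open>S\<close>.\<close>

definition balanced :: "(int \<times> int) set \<Rightarrow> int \<times> int \<Rightarrow> bool" where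
  "balanced S v \<longleftrightarrow> share S v \<le> 10 / 3 \<or> share S v \<le> 7 / 2 \<and>
     ((\<forall>w\<in>nbhd v \<inter> S. quiet S v w) \<or> (\<exists>w\<in>nbhd v \<inter> S. ndom S w = 2 \<and> share S w \<le> 3))"

context
  fixes g
  assumes g: "king_aut g"
begin

lemma nbhd_aut: "nbhd v = g -` nbhd (g v)" "nbhd (g v) = g ` nbhd v"
proof -
  show 1: "nbhd v = g -` nbhd (g v)"
    using g unfolding king_aut_def open_nbhd_def vimage_def by blast
  have "g ` g -` nbhd (g v) = nbhd (g v)"
    using g unfolding king_aut_def by (simp add: bij_is_surj surj_image_vimage_eq)
  then show "nbhd (g v) = g ` nbhd v" using 1 by simp
qed

lemma card_vimage_aut: "card (g -` A) = card A"
  using g unfolding king_aut_def by (intro card_vimage_inj) (auto simp: bij_is_inj bij_is_surj)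

lemma ndom_vimage: "ndom (g -` S) v = ndom S (g v)"
  unfolding ndom_def nbhd_aut(1)[of v] vimage_Int[symmetric] by (rule card_vimage_aut)

lemma share_vimage: "share (g -` S) v = share S (g v)"
proof -
  have "inj_on g A" for A
    using g unfolding king_aut_def by (meson bij_is_inj inj_on_subset subset_UNIV)
  then show ?thesis
    unfolding share_def nbhd_aut(2) by (simp add: sum.reindex weight_def ndom_vimage)
qed

lemma nbhd_Int_aut: "nbhd (g v) \<inter> S = g ` (nbhd v \<inter> g -` S)"
  unfolding nbhd_aut(2) by blast

lemma quiet_vimage: "quiet (g -` S) v w = quiet S (g v) (g w)"
proof -
  have "g y = g v \<longleftrightarrow> y = v" for y
    using g unfolding king_aut_def by (meson bij_is_inj injD)
  then show ?thesis unfolding quiet_def nbhd_Int_aut[of w] share_vimage by simp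
qed

text \<open>Everything involved depends on adjacency only, so pulling \<open>S\<close> back along
  \<open>g\<close> lets local claims be proved at the origin in one orientation.\<close>

lemma balanced_vimage: "balanced (g -` S) v = balanced S (g v)"
  unfolding balanced_def nbhd_Int_aut[of v] share_vimage quiet_vimage ndom_vimage by simp

lemma red_old_vimage:
  assumes "red_old S"
  shows "red_old (g -` S)"
proof -
  interpret red_old S by fact
  have "card ((nbhd u - nbhd v \<union> (nbhd v - nbhd u)) \<inter> g -` S) \<ge> 2" if "u \<noteq> v" for u v
  proof -
    have "g u \<noteq> g v" using that g unfolding king_aut_def by (meson bij_is_inj injD)
    then have "card ((nbhd (g u) - nbhd (g v) \<union> (nbhd (g v) - nbhd (g u))) \<inter> S) \<ge> 2"
      by (rule nbhd_diff_ge_2)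
    moreover have "(nbhd u - nbhd v \<union> (nbhd v - nbhd u)) \<inter> g -` S =
        g -` ((nbhd (g u) - nbhd (g v) \<union> (nbhd (g v) - nbhd (g u))) \<inter> S)"
      unfolding nbhd_aut(1)[of u] nbhd_aut(1)[of v] by blast
    ultimately show ?thesis by (simp only: card_vimage_aut)
  qed
  then show ?thesis unfolding red_old_def by (simp add: ndom_vimage ndom_ge_2)
qed

end

section \<open>Vertices of large share\<close>

lemma share_orth_general:
  assumes S: "red_old S" and "(a, b) \<in> S" "{(a+1,b), (a-1,b), (a,b+1), (a,b-1)} \<inter> S \<noteq> {}"
  shows "share S (a, b) \<le> 10 / 3"
proof -
  let ?s = "\<lambda>(x, y). (a + x, b + y)" and ?f = "\<lambda>(x, y). (- x, y)" and ?w = "\<lambda>(x, y). (y, x)"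
  have *: "share S (g (0, 0)) \<le> 10 / 3" if "king_aut g" "g (0, 0) \<in> S" "g (1, 0) \<in> S" for g
    using red_old.share_orth[OF red_old_vimage[OF that(1) S]] that(2,3)
    by (simp add: share_vimage[OF that(1)])
  have aut: "king_aut ?s" "king_aut (?s \<circ> ?f)" "king_aut (?s \<circ> ?w)" "king_aut (?s \<circ> (?w \<circ> ?f))"
    by (intro king_aut_comp king_aut_shift king_aut_flip king_aut_swap)+
  from assms(3) consider "(a+1,b) \<in> S" | "(a-1,b) \<in> S" | "(a,b+1) \<in> S" | "(a,b-1) \<in> S" by auto
  then show ?thesis
    by cases (use *[OF aut(1)] *[OF aut(2)] *[OF aut(3)] *[OF aut(4)] assms(2) in simp_all)
qed

lemma quiet_left:
  assumes "red_old S" and S: "(0, 0) \<in> S" "(-1,1) \<in> S"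
    and iso: "{(-1,-1), (-1,0), (0,1), (0,-1)} \<inter> S = {}"
    and ndom: "ndom S (-1,1) = 2" "ndom S (-1,-1) = 2" "ndom S (-1,0) \<ge> 4"
  shows "quiet S (0, 0) (-1,1)"
proof -
  interpret red_old S by fact
  \<comment> \<open>Without \<open>(-2,1)\<close>, the trace of \<open>(-1,0)\<close> could reach
    size 4 only through \<open>(-2,-1)\<close> and \<open>(-2,0)\<close>, which would give
    \<open>(-1,-1)\<close> a trace of size 3.\<close>
  have in_S: "(-2,1) \<in> S"
  proof (rule ccontr)
    assume "(-2,1) \<notin> S"
    have "ndom S (-1,0) = 2 + of_bool ((-2,-1) \<in> S) + of_bool ((-2,0) \<in> S) + of_bool ((-2,1) \<in> S)"
      using S iso by (simp add: ndom_eq_sum sum_nbhd)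
    then have "(-2,-1) \<in> S" "(-2,0) \<in> S"
      using ndom(3) \<open>(-2,1) \<notin> S\<close> by (auto simp: of_bool_def split: if_splits)
    then show False
      using ndom_ge[of "{(0,0), (-2,-1), (-2,0)}" "(-1,-1)" S] ndom(2) S by (simp add: nbhd_eq)
  qed
  then have nbhd: "nbhd (-1,1) \<inter> S = {(0,0), (-2,1)}"
    by (intro nbhd_Int_eqI ndom(1)) (use S in \<open>simp_all add: nbhd_eq\<close>)
  have "sum (weight S) {(-1,0), (-2,0), (-1,2), (-2,2)} \<le> 5 / 4"
    by (rule sum_weight_le(2)[where a = "(-1,1)" and b = "(-2,1)"])
      (use S in_S ndom(3) in \<open>auto simp: nbhd_eq\<close>)
  then have "share S (-1,1) \<le> 13 / 4"
    using weight_le_half[of "(0,0)"] weight_le_half[of "(0,1)"] weight_le_half[of "(0,2)"]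
      weight_le_half[of "(-2,1)"]
    unfolding share_def sum_nbhd by simp
  \<comment> \<open>The orthogonal neighbour \<open>(-1,1)\<close> is in \<open>S\<close>, so
    \<open>(-2,1)\<close> cannot be exceptional.\<close>
  moreover have "share S (-2,1) \<le> 10 / 3"
    using assms(1) in_S by (rule share_orth_general) (use S in simp)
  ultimately show ?thesis unfolding quiet_def nbhd by simp
qed

lemma quiet_antipodal:
  assumes "red_old S" and S: "(0, 0) \<in> S" "{(-1,1), (1,-1)} \<subseteq> S"
    and iso: "{(-1,-1), (1,1), (-1,0), (0,1), (0,-1), (1,0)} \<inter> S = {}"
    and high: "10 / 3 < share S (0, 0)"
  shows "quiet S (0, 0) (-1,1)"
proof -
  interpret red_old S by fact
  note corner = high_antipodal(4)[OF S high]
  have c2: "ndom S (1,1) = 2" "ndom S (-1,-1) = 2" "ndom S (-1,1) = 2"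
    by (rule corner; simp)+
  show ?thesis
  proof (cases "ndom S (-1,0) = 2")
    case False
    then have "ndom S (-1,0) \<ge> 4" by (intro ndom_orth_ge_4) (use S iso c2 in auto)
    then show ?thesis by (intro quiet_left assms) (use S iso c2 in auto)
  next
    case True
    have "ndom S (0,1) \<ge> 4"
      by (rule ndom_ge_4[OF True, of "(0,0)" "(-1,1)"]) (use S in \<open>simp_all add: nbhd_eq\<close>)
    \<comment> \<open>The reflection \<open>(x, y) -> (-y, -x)\<close>, which fixes
      \<open>(-1,1)\<close> and swaps \<open>(-1,0)\<close> with \<open>(0,1)\<close>.\<close>
    let ?g = "(\<lambda>(x, y). (- x, y)) \<circ> (\<lambda>(x, y). (y, x)) \<circ> (\<lambda>(x, y). (- x, y))"
    have g: "king_aut ?g" by (intro king_aut_comp king_aut_flip king_aut_swap)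
    have "quiet (?g -` S) (0, 0) (-1,1)"
      by (intro quiet_left red_old_vimage[OF g] assms)
        (use S iso c2 \<open>ndom S (0,1) \<ge> 4\<close> in \<open>simp_all add: ndom_vimage[OF g]\<close>)
    then show ?thesis by (simp add: quiet_vimage[OF g])
  qed
qed

lemma balanced_antipodal:
  assumes "red_old S" and S: "(0, 0) \<in> S" "{(-1,1), (1,-1)} \<subseteq> S"
    and iso: "{(-1,0), (0,1), (0,-1), (1,0)} \<inter> S = {}"
  shows "balanced S (0, 0)"
proof (cases "share S (0, 0) \<le> 10 / 3")
  case True
  then show ?thesis by (simp add: balanced_def)
next
  case False
  interpret red_old S by fact
  have high: "10 / 3 < share S (0, 0)" using False by simp
  \<comment> \<open>The half-turn \<open>(x, y) -> (-x, -y)\<close>.\<close>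
  let ?g = "(\<lambda>(x, y). (y, x)) \<circ> (\<lambda>(x, y). (- x, y)) \<circ> (\<lambda>(x, y). (y, x)) \<circ> (\<lambda>(x, y). (- x, y))"
  have g: "king_aut ?g" by (intro king_aut_comp king_aut_flip king_aut_swap)
  interpret g: red_old "?g -` S" by (rule red_old_vimage[OF g assms(1)])
  have high': "10 / 3 < share (?g -` S) (0, 0)" using high by (simp add: share_vimage[OF g])
  consider "(1,1) \<in> S" | "(-1,-1) \<in> S" | "{(1,1), (-1,-1)} \<inter> S = {}" by blast
  then have "(\<forall>w\<in>nbhd (0,0) \<inter> S. quiet S (0,0) w) \<or> (\<exists>w\<in>nbhd (0,0) \<inter> S. ndom S w = 2 \<and> share S w \<le> 3)"
  proof cases
    case 1
    then have "ndom S (1,1) = 2 \<and> share S (1,1) \<le> 3"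
      using share_three_diagonals[OF _ _ _ high] S iso by simp
    moreover have "(1,1) \<in> nbhd (0,0)" by (simp add: nbhd_eq)
    ultimately show ?thesis using 1 by blast
  next
    case 2
    then have "ndom (?g -` S) (1,1) = 2 \<and> share (?g -` S) (1,1) \<le> 3"
      using g.share_three_diagonals[OF _ _ _ high'] S iso by simp
    then have "ndom S (-1,-1) = 2 \<and> share S (-1,-1) \<le> 3"
      by (simp add: ndom_vimage[OF g] share_vimage[OF g])
    moreover have "(-1,-1) \<in> nbhd (0,0)" by (simp add: nbhd_eq)
    ultimately show ?thesis using 2 by blast
  next
    case 3
    have "quiet S (0,0) (-1,1)"
      by (intro quiet_antipodal assms high) (use S iso 3 in auto)
    moreover have "quiet (?g -` S) (0,0) (-1,1)"
      by (intro quiet_antipodal g.red_old_axioms high') (use S iso 3 in auto)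
    then have "quiet S (0,0) (1,-1)" by (simp add: quiet_vimage[OF g])
    moreover have "nbhd (0,0) \<inter> S \<subseteq> {(-1,1), (1,-1)}"
      using iso 3 by (auto simp: nbhd_eq)
    ultimately show ?thesis by blast
  qed
  then show ?thesis using high_antipodal(3)[OF S high] unfolding balanced_def by blast
qed

lemma balanced_origin:
  assumes S: "red_old S" "(0, 0) \<in> S"
  shows "balanced S (0, 0)"
proof (cases "{(-1,0), (0,1), (0,-1), (1,0)} \<inter> S = {}")
  case False
  then have "share S (0, 0) \<le> 10 / 3" by (intro share_orth_general S) auto
  then show ?thesis by (simp add: balanced_def)
next
  case iso: True
  let ?f = "\<lambda>(x :: int, y :: int). (- x, y)" and ?w = "\<lambda>(x :: int, y :: int). (y, x)"
  have anti: "balanced S (g (0, 0))" if "king_aut g" "g (0, 0) \<in> S" "{g (-1,1), g (1,-1)} \<subseteq> S"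
      "{g (-1,0), g (0,1), g (0,-1), g (1,0)} \<inter> S = {}" for g
    using balanced_antipodal[OF red_old_vimage[OF that(1) S(1)]] that(2-)
    by (simp add: balanced_vimage[OF that(1)])
  have adj: "balanced S (g (0, 0))" if "king_aut g" "g (0, 0) \<in> S" "{g (1,1), g (1,-1)} \<subseteq> S"
      "{g (-1,1), g (-1,-1), g (0,1), g (0,-1), g (-1,0), g (1,0)} \<inter> S = {}" for g
    using red_old.share_adjacent_diagonals[OF red_old_vimage[OF that(1) S(1)]] that(2-)
    by (simp add: share_vimage[OF that(1)] balanced_def)
  \<comment> \<open>The first map is the identity, written as a shift.\<close>
  have aut: "king_aut (\<lambda>(x, y). (0 + x, 0 + y))" "king_aut ?f" "king_aut ?w" "king_aut (?w \<circ> ?f)"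
    by (intro king_aut_comp king_aut_flip king_aut_swap king_aut_shift)+
  interpret red_old S by fact
  have "2 \<le> of_bool ((-1,-1) \<in> S) + of_bool ((-1,1) \<in> S) + of_bool ((1,-1) \<in> S) + (of_bool ((1,1) \<in> S) :: nat)"
    using ndom_ge_2[of "(0,0)"] iso by (simp add: ndom_eq_sum sum_nbhd)
  then consider "(-1,1) \<in> S \<and> (1,-1) \<in> S" | "(1,1) \<in> S \<and> (-1,-1) \<in> S"
    | "(1,1) \<in> S \<and> (1,-1) \<in> S \<and> (-1,1) \<notin> S \<and> (-1,-1) \<notin> S"
    | "(-1,1) \<in> S \<and> (-1,-1) \<in> S \<and> (1,1) \<notin> S \<and> (1,-1) \<notin> S"
    | "(1,1) \<in> S \<and> (-1,1) \<in> S \<and> (1,-1) \<notin> S \<and> (-1,-1) \<notin> S"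
    | "(1,-1) \<in> S \<and> (-1,-1) \<in> S \<and> (1,1) \<notin> S \<and> (-1,1) \<notin> S"
    by (cases "(-1,-1) \<in> S"; cases "(-1,1) \<in> S"; cases "(1,-1) \<in> S"; cases "(1,1) \<in> S") simp_all
  then show ?thesis
  proof cases
    case 1 then show ?thesis using anti[OF aut(1)] S(2) iso by simp
  next
    case 2 then show ?thesis using anti[OF aut(2)] S(2) iso by simp
  next
    case 3 then show ?thesis using adj[OF aut(1)] S(2) iso by simp
  next
    case 4 then show ?thesis using adj[OF aut(2)] S(2) iso by simp
  next
    case 5 then show ?thesis using adj[OF aut(3)] S(2) iso by simp
  next
    case 6 then show ?thesis using adj[OF aut(4)] S(2) iso by simp
  qed
qed

lemma balanced:
  assumes "red_old S" "v \<in> S"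
  shows "balanced S v"
proof -
  obtain a b where v: "v = (a, b)" by (cases v)
  have g: "king_aut (\<lambda>(x, y). (a + x, b + y))" by (rule king_aut_shift)
  show ?thesis
    using balanced_origin[OF red_old_vimage[OF g assms(1)]] assms(2)
    by (simp add: balanced_vimage[OF g] v)
qed

section \<open>Discharging\<close>

definition sink :: "(int \<times> int) set \<Rightarrow> int \<times> int \<Rightarrow> int \<times> int \<Rightarrow> bool" where
  "sink S v w \<longleftrightarrow> w \<in> nbhd v \<inter> S \<and> ndom S w = 2 \<and> share S w \<le> 3"

text \<open>\<open>SOME\<close> directs the whole \<open>1 / 6\<close> to a single sink even if
  there are several. Without a sink, at least two neighbours in \<open>S\<close> receive
  \<open>1 / 12\<close> each.\<close>

definition flow :: "(int \<times> int) set \<Rightarrow> int \<times> int \<Rightarrow> int \<times> int \<Rightarrow> real" where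
  "flow S v w =
     (if v \<in> S \<and> share S v > 10 / 3 \<and> w \<in> nbhd v \<inter> S
      then if \<exists>x. sink S v x then if w = (SOME x. sink S v x) then 1 / 6 else 0 else 1 / 12
      else 0)"

lemma flow_bounds: "0 \<le> flow S v w" "flow S v w \<le> 1 / 6"
  by (simp_all add: flow_def)

lemma sum_flow_le: "(\<Sum>v\<in>nbhd w. flow S v w) \<le> ndom S w * (1 / 6)"
proof -
  have "(\<Sum>v\<in>nbhd w. flow S v w) = (\<Sum>v\<in>nbhd w \<inter> S. flow S v w)"
    by (intro sum.mono_neutral_right) (auto simp: flow_def)
  also have "\<dots> \<le> of_nat (card (nbhd w \<inter> S)) * (1 / 6)"
    by (intro sum_bounded_above flow_bounds)
  finally show ?thesis by (simp add: ndom_def)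
qed

lemma share_le_outflow:
  assumes "red_old S" "v \<in> S"
  shows "share S v \<le> 10 / 3 + (\<Sum>w\<in>nbhd v. flow S v w)"
proof (cases "share S v \<le> 10 / 3")
  case True
  moreover have "0 \<le> (\<Sum>w\<in>nbhd v. flow S v w)" by (simp add: sum_nonneg flow_bounds)
  ultimately show ?thesis by simp
next
  case False
  interpret red_old S by fact
  have "share S v \<le> 7 / 2" using balanced[OF assms] False by (simp add: balanced_def)
  moreover have "1 / 6 \<le> (\<Sum>w\<in>nbhd v. flow S v w)"
  proof (cases "\<exists>x. sink S v x")
    case True
    then have *: "sink S v (SOME x. sink S v x)" by (rule someI_ex)
    then have "flow S v (SOME x. sink S v x) = 1 / 6"
      using True False assms(2) * unfolding flow_def sink_def[of S v "SOME x. sink S v x"] by simp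
    moreover have "flow S v (SOME x. sink S v x) \<le> (\<Sum>w\<in>nbhd v. flow S v w)"
      using * by (intro member_le_sum) (auto simp: sink_def flow_bounds)
    ultimately show ?thesis by simp
  next
    case none: False
    have "1 / 6 \<le> of_nat (card (nbhd v \<inter> S)) * (1 / 12 :: real)"
      using ndom_ge_2[of v] by (simp add: ndom_def)
    also have "\<dots> = (\<Sum>w\<in>nbhd v \<inter> S. flow S v w)"
      using none False assms(2) by (simp add: flow_def)
    also have "\<dots> \<le> (\<Sum>w\<in>nbhd v. flow S v w)"
      by (intro sum_mono2) (auto simp: flow_bounds)
    finally show ?thesis .
  qed
  ultimately show ?thesis by simp
qed

lemma share_inflow_le:
  assumes "red_old S" "w \<in> S" "(\<Sum>v\<in>nbhd w. flow S v w) \<noteq> 0"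
  shows "share S w + (\<Sum>v\<in>nbhd w. flow S v w) \<le> 10 / 3"
proof (cases "ndom S w = 2 \<and> share S w \<le> 3")
  case True
  then show ?thesis using sum_flow_le[of S w] by simp
next
  case False
  obtain v where v: "v \<in> nbhd w" "flow S v w \<noteq> 0"
    using assms(3) by (meson sum.neutral)
  \<comment> \<open>A vertex with a sink sends nothing elsewhere, and \<open>w\<close> is not a
    sink.\<close>
  have sink: "\<not> sink S v x" for x
  proof
    assume "sink S v x"
    then have "sink S v (SOME x. sink S v x)" by (rule someI)
    moreover have "w = (SOME x. sink S v x)"
      using v(2) \<open>sink S v x\<close> unfolding flow_def by presburger
    ultimately show False using False by (simp add: sink_def)
  qed
  have vS: "v \<in> S" "share S v > 10 / 3" "w \<in> nbhd v \<inter> S"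
    using v(2) unfolding flow_def by presburger+
  then have "quiet S v w"
    using balanced[OF assms(1) vS(1)] sink unfolding balanced_def sink_def by fastforce
  \<comment> \<open>Quietness makes \<open>v\<close> the sole donor, and
    \<open>13 / 4 + 1 / 12 = 10 / 3\<close>.\<close>
  then have "flow S y w = 0" if "y \<in> nbhd w - {v}" for y
    using that unfolding quiet_def flow_def by (cases "y \<in> S") auto
  then have "(\<Sum>v\<in>nbhd w. flow S v w) = flow S v w"
    using v(1) by (simp add: sum.remove[of _ v])
  also have "\<dots> = 1 / 12" using vS sink by (simp add: flow_def)
  finally show ?thesis using \<open>quiet S v w\<close> by (simp add: quiet_def)
qed

lemma share_flow_le:
  assumes "red_old S" "v \<in> S"
  shows "share S v + (\<Sum>w\<in>nbhd v. flow S w v) \<le> 10 / 3 + (\<Sum>w\<in>nbhd v. flow S v w)"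
proof (cases "(\<Sum>w\<in>nbhd v. flow S w v) = 0")
  case True
  then show ?thesis using share_le_outflow[OF assms] by simp
next
  case False
  have "0 \<le> (\<Sum>w\<in>nbhd v. flow S v w)" by (simp add: sum_nonneg flow_bounds)
  then show ?thesis using share_inflow_le[OF assms False] by simp
qed

section \<open>Counting on boxes\<close>

lemma finite_king_box [simp]: "finite (king_box n)"
  by (simp add: king_box_def)

lemma card_king_box: "card (king_box n) = (2 * n + 1) ^ 2"
proof -
  have "card {- int n..int n} = 2 * n + 1" by simp
  then show ?thesis unfolding king_box_def by (simp only: card_cartesian_product power2_eq_square)
qed

lemma king_box_Suc: "king_box n \<subseteq> king_box (Suc n)"
  by (auto simp: king_box_def)

lemma nbhd_king_box: "u \<in> king_box n \<Longrightarrow> nbhd u \<subseteq> king_box (Suc n)"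
  by (cases u) (auto simp: king_box_def nbhd_eq)

lemma card_king_box_le_sum_share:
  assumes "red_old S"
  shows "card (king_box n) \<le> sum (share S) (S \<inter> king_box (Suc n))"
proof -
  interpret red_old S by fact
  let ?A = "S \<inter> king_box (Suc n)"
  \<comment> \<open>Since \<open>1 / 0 = 0\<close>, distributing exactly 1 requires a nonempty
    trace.\<close>
  have one: "(\<Sum>v\<in>nbhd u \<inter> S. weight S u) = 1" for u
  proof -
    have "ndom S u \<noteq> 0" using ndom_ge_2[of u] by simp
    then show ?thesis by (simp add: weight_def flip: ndom_def)
  qed
  have "real (card (king_box n)) = (\<Sum>u\<in>king_box n. \<Sum>v\<in>nbhd u \<inter> S. weight S u)"
    by (simp only: one) simp
  also have "\<dots> = (\<Sum>u\<in>king_box n. \<Sum>v\<in>{v \<in> ?A. u \<in> nbhd v}. weight S u)"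
  proof (intro sum.cong refl)
    fix u assume "u \<in> king_box n"
    then have "nbhd u \<subseteq> king_box (Suc n)" by (rule nbhd_king_box)
    then show "nbhd u \<inter> S = {v \<in> ?A. u \<in> nbhd v}" by (auto simp: nbhd_sym[of u])
  qed
  also have "\<dots> = (\<Sum>v\<in>?A. \<Sum>u\<in>{u \<in> king_box n. u \<in> nbhd v}. weight S u)"
    by (rule sum.swap_restrict) simp_all
  also have "\<dots> \<le> (\<Sum>v\<in>?A. share S v)"
    unfolding share_def by (intro sum_mono sum_mono2) (auto simp: weight_def)
  finally show ?thesis .
qed

text \<open>Flow inside the box cancels. What leaves it lands in the surrounding shell, where each
  vertex receives at most \<open>8 * (1 / 6) = 4 / 3\<close>.\<close>

lemma sum_outflow_le:
  "(\<Sum>v\<in>S \<inter> king_box n. \<Sum>w\<in>nbhd v. flow S v w)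
    \<le> (\<Sum>w\<in>S \<inter> king_box n. \<Sum>v\<in>nbhd w. flow S v w) + (card (king_box (Suc n)) - card (king_box n)) * (4 / 3)"
proof -
  let ?A = "S \<inter> king_box n" and ?B = "S \<inter> king_box (Suc n)"
  have "(\<Sum>v\<in>?A. \<Sum>w\<in>nbhd v. flow S v w) = (\<Sum>v\<in>?A. \<Sum>w\<in>{w \<in> ?B. w \<in> nbhd v}. flow S v w)"
  proof (rule sum.cong[OF refl])
    fix v assume "v \<in> ?A"
    then have "nbhd v \<subseteq> king_box (Suc n)" by (intro nbhd_king_box) simp
    then show "(\<Sum>w\<in>nbhd v. flow S v w) = (\<Sum>w\<in>{w \<in> ?B. w \<in> nbhd v}. flow S v w)"
      by (intro sum.mono_neutral_right) (auto simp: flow_def)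
  qed
  also have "\<dots> = (\<Sum>w\<in>?B. \<Sum>v\<in>{v \<in> ?A. w \<in> nbhd v}. flow S v w)"
    by (rule sum.swap_restrict) simp_all
  also have "\<dots> \<le> (\<Sum>w\<in>?B. \<Sum>v\<in>nbhd w. flow S v w)"
    by (intro sum_mono sum_mono2) (auto simp: nbhd_sym flow_bounds)
  also have "\<dots> = (\<Sum>w\<in>?A. \<Sum>v\<in>nbhd w. flow S v w) + (\<Sum>w\<in>?B - ?A. \<Sum>v\<in>nbhd w. flow S v w)"
    using king_box_Suc[of n] by (subst sum.subset_diff[of ?A ?B]) (auto simp: add.commute)
  also have "(\<Sum>w\<in>?B - ?A. \<Sum>v\<in>nbhd w. flow S v w) \<le> of_nat (card (?B - ?A)) * (4 / 3)"
  proof (intro sum_bounded_above)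
    fix w
    have "ndom S w \<le> card (nbhd w)" unfolding ndom_def by (simp add: card_mono)
    then show "(\<Sum>v\<in>nbhd w. flow S v w) \<le> 4 / 3"
      using sum_flow_le[of S w] by (simp add: card_nbhd)
  qed
  also have "card (?B - ?A) \<le> card (king_box (Suc n) - king_box n)"
    by (intro card_mono) auto
  also have "\<dots> = card (king_box (Suc n)) - card (king_box n)"
    using king_box_Suc by (simp add: card_Diff_subset)
  finally show ?thesis by simp
qed

lemma card_king_box_le:
  assumes "red_old S"
  shows "real (2 * n + 1) ^ 2 \<le> 10 / 3 * card (S \<inter> king_box (Suc n)) + 4 / 3 * (8 * n + 16)"
proof -
  let ?A = "S \<inter> king_box (Suc n)"
  have "(\<Sum>v\<in>?A. share S v + (\<Sum>w\<in>nbhd v. flow S w v)) \<le>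
      (\<Sum>v\<in>?A. 10 / 3 + (\<Sum>w\<in>nbhd v. flow S v w))"
    by (intro sum_mono share_flow_le assms) simp
  then have "sum (share S) ?A + (\<Sum>v\<in>?A. \<Sum>w\<in>nbhd v. flow S w v) \<le>
      10 / 3 * card ?A + (\<Sum>v\<in>?A. \<Sum>w\<in>nbhd v. flow S v w)"
    by (simp add: sum.distrib)
  moreover have "card (king_box (Suc (Suc n))) - card (king_box (Suc n)) = 8 * n + 16"
    by (simp add: card_king_box power2_eq_square)
  ultimately show ?thesis
    using sum_outflow_le[of S "Suc n"] card_king_box_le_sum_share[OF assms, of n]
    by (simp add: card_king_box)
qed

lemma card_ratio_ge:
  assumes "red_old S"
  shows "3 / 10 - 4 * inverse (real (Suc n)) \<le> card (S \<inter> king_box (Suc n)) / card (king_box (Suc n))"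
proof -
  define m where "m = real (2 * n + 3)"
  define c where "c = real (card (S \<inter> king_box (Suc n)))"
  have m: "m > 0" "real (Suc n) \<le> m" by (simp_all add: m_def)
  have "(m - 2) ^ 2 \<le> 10 / 3 * c + 4 / 3 * (4 * m + 4)"
    using card_king_box_le[OF assms, of n] by (simp add: m_def c_def algebra_simps)
  moreover have "m \<ge> 3" by (simp add: m_def)
  \<comment> \<open>The inequality says \<open>c \<ge> 3 / 10 * m ^ 2 - 14 / 5 * m - 2 / 5\<close>,
    and the last two terms together cost at most \<open>4 * m\<close>.\<close>
  ultimately have "(3 / 10 - 4 / m) * m ^ 2 \<le> c"
    using m(1) by (simp add: power2_eq_square algebra_simps)
  then have "3 / 10 - 4 / m \<le> c / m ^ 2" using m(1) by (simp add: pos_le_divide_eq)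
  moreover have "4 / m \<le> 4 * inverse (real (Suc n))"
    using m by (simp add: divide_inverse le_imp_inverse_le)
  moreover have "real (card (king_box (Suc n))) = m ^ 2" by (simp add: card_king_box m_def)
  ultimately show ?thesis unfolding c_def by simp
qed

lemma king_density_ge:
  assumes "red_old S"
  shows "ereal (3 / 10) \<le> king_density S"
proof -
  let ?f = "\<lambda>n. ereal (card (S \<inter> king_box n) / card (king_box n))"
  have "(\<lambda>n. 3 / 10 - 4 * inverse (real n)) \<longlonglongrightarrow> 3 / 10 - 4 * 0"
    by (intro tendsto_intros lim_inverse_n)
  then have "(\<lambda>n. ereal (3 / 10 - 4 * inverse (real n))) \<longlonglongrightarrow> ereal (3 / 10)"
    by simp
  then have "ereal (3 / 10) = limsup (\<lambda>n. ereal (3 / 10 - 4 * inverse (real n)))"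
    by (intro lim_imp_Limsup[symmetric]) simp_all
  also have "\<dots> \<le> limsup ?f"
  \<comment> \<open>Index 0 is skipped: there \<open>inverse\<close> is 0 by default and the bound
    can fail.\<close>
  proof (intro Limsup_mono eventually_sequentiallyI[of 1])
    fix n :: nat assume "1 \<le> n"
    then obtain k where "n = Suc k" by (cases n) auto
    then show "ereal (3 / 10 - 4 * inverse (real n)) \<le> ?f n"
      using card_ratio_ge[OF assms, of k] by simp
  qed
  finally show ?thesis unfolding king_density_def .
qed

theorem corollary5p1:
  shows "RED_OLD_percent_king \<ge> ereal (3 / 10)"
  unfolding RED_OLD_percent_king_def
  by (rule INF_greatest) (simp add: red_oldI king_density_ge)

end
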